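(* For any fixed $a>0$ and $N\ge1$, there exist a map $\Phi_{N,a}:\mathbb R^N\to\mathcal H^+(\overline B^{\,2}(a),\lambda_{\rm std})$, $v\mapsto\Phi_{N,a}(v)$, and a constant $c_N>0$, depending only on $N$, such that $$d_{\rm T}(\Phi_{N,a}(v),\Phi_{N,a}(w))\ge c_N\|v-w\|_\infty$$ for all $v,w\in\mathbb R^N$.
   Context: $\overline B^{\,2}(a)=\{u\in\mathbb C\mid\pi|u|^2\le a\}$ with the standard Liouville form $\lambda_{\rm std}=\frac12r^2d\theta$ is a Liouville domain. For a Liouville domain $(W,\lambda)$ (compact, $d\lambda$ symplectic, with the vector field $Y_\lambda$ given by $\iota_{Y_\lambda}d\lambda=\lambda$ outward transverse to $\partial W$), $S^1=\mathbb R/\mathbb Z$ and smooth $H:S^1\times W\to\mathbb R$, put $H_t=H(t,\cdot)$, define $X_{H_t}$ by $\iota_{X_{H_t}}d\lambda=dH_t$, and $\tau_{\lambda,H}=\lambda(X_{H_t})+H$. $\mathcal H(W,\lambda)$ is the set of smooth $H:S^1\times W\to\mathbb R$ which are autonomous in a neighborhood of $\partial W$, vanish on $\partial W$, and satisfy $\tau_{\lambda,H}>0$ everywhere; $\mathcal H^+(W,\lambda)=\{H\in\mathcal H(W,\lambda)\mid\lambda(X_{H_t})\ge0\text{ on }S^1\times W\}$. ${\rm Symp}(W,\lambda)$ is the group of diffeomorphisms $\psi$ of $W$ with $\psi^*\lambda=\lambda$. The Thompson-type distance is $d_{\rm T}(H,G)=\inf\{\ln C\ge0\mid\exists\,\varphi\in{\rm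 Symp}(W,\lambda)\text{ with }\frac1CH\le G\circ\varphi\le CH\}$, where $(G\circ\varphi)(t,w)=G(t,\varphi(w))$. *)

theory Defs
  imports "HOL-Analysis.Analysis"
begin

section \<open>Smooth maps on open and on arbitrary sets\<close>

primrec Ck_on :: "nat \<Rightarrow> 'a::real_normed_vector set \<Rightarrow> ('a \<Rightarrow> 'b::real_normed_vector) \<Rightarrow> bool" where
  "Ck_on 0 U f \<longleftrightarrow> continuous_on U f"
| "Ck_on (Suc k) U f \<longleftrightarrow> (\<forall>x\<in>U. f differentiable at x) \<and>
     (\<forall>v. Ck_on k U (\<lambda>x. frechet_derivative f (at x) v))"

text \<open>Smoothness on a set that need not be open (such as a manifold with boundary) means the
  existence of local smooth extensions.\<close>

definition smooth_on :: "'a::euclidean_space set \<Rightarrow> ('a \<Rightarrow> 'b::euclidean_space) \<Rightarrow> bool" where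
  "smooth_on S f \<longleftrightarrow> (\<forall>x\<in>S. \<exists>U g. open U \<and> x \<in> U \<and> (\<forall>k. Ck_on k U g) \<and> (\<forall>y\<in>U \<inter> S. g y = f y))"

section \<open>Hamiltonians on an exact symplectic domain\<close>

text \<open>
  The domain \<open>W\<close> is the closure of a bounded open set with smooth boundary in a Euclidean space
  \<open>'a\<close>, so its manifold boundary is \<open>frontier W\<close> and every tangent space is \<open>'a\<close>. A 1-form is
  \<open>\<alpha>\<close> with \<open>\<alpha> x v\<close> its value at the point \<open>x\<close> on the tangent vector \<open>v\<close>. Derivatives are taken
  within \<open>W\<close>; they are unique also at boundary points, and at interior points they are the usual
  ones. A function on the circle (the reals modulo the integers) times \<open>W\<close> is a 1-periodic
  function of the first argument; values outside \<open>W\<close> are irrelevant.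
\<close>

definition diff_in :: "'a::euclidean_space set \<Rightarrow> ('a \<Rightarrow> 'b::euclidean_space) \<Rightarrow> 'a \<Rightarrow> 'a \<Rightarrow> 'b" where
  "diff_in W f x = frechet_derivative f (at x within W)"

text \<open>In the next definition \<open>u\<close> and \<open>v\<close> are constant, hence commuting, vector fields, so the
  bracket term of the invariant formula for the exterior derivative vanishes.\<close>

definition ext_deriv ::
  "'a::euclidean_space set \<Rightarrow> ('a \<Rightarrow> 'a \<Rightarrow> real) \<Rightarrow> 'a \<Rightarrow> 'a \<Rightarrow> 'a \<Rightarrow> real" where
  "ext_deriv W \<alpha> x u v = diff_in W (\<lambda>y. \<alpha> y v) x u - diff_in W (\<lambda>y. \<alpha> y u) x v"

definition ham_vf ::
  "'a::euclidean_space set \<Rightarrow> ('a \<Rightarrow> 'a \<Rightarrow> real) \<Rightarrow> ('a \<Rightarrow> real) \<Rightarrow> 'a \<Rightarrow> 'a" where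
  "ham_vf W \<alpha> h x = (THE X. \<forall>v. ext_deriv W \<alpha> x X v = diff_in W h x v)"

definition tau ::
  "'a::euclidean_space set \<Rightarrow> ('a \<Rightarrow> 'a \<Rightarrow> real) \<Rightarrow> (real \<Rightarrow> 'a \<Rightarrow> real) \<Rightarrow> real \<Rightarrow> 'a \<Rightarrow> real" where
  "tau W \<alpha> H t x = \<alpha> x (ham_vf W \<alpha> (H t) x) + H t x"

definition hamiltonians ::
  "'a::euclidean_space set \<Rightarrow> ('a \<Rightarrow> 'a \<Rightarrow> real) \<Rightarrow> (real \<Rightarrow> 'a \<Rightarrow> real) set" where
  "hamiltonians W \<alpha> = {H.
     (\<forall>t. \<forall>x\<in>W. H (t + 1) x = H t x) \<and>
     smooth_on (UNIV \<times> W) (\<lambda>(t, x). H t x) \<and>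
     (\<exists>U. open U \<and> frontier W \<subseteq> U \<and> (\<forall>s t. \<forall>x\<in>U \<inter> W. H s x = H t x)) \<and>
     (\<forall>t. \<forall>x\<in>frontier W. H t x = 0) \<and>
     (\<forall>t. \<forall>x\<in>W. tau W \<alpha> H t x > 0)}"

definition hamiltonians_plus ::
  "'a::euclidean_space set \<Rightarrow> ('a \<Rightarrow> 'a \<Rightarrow> real) \<Rightarrow> (real \<Rightarrow> 'a \<Rightarrow> real) set" where
  "hamiltonians_plus W \<alpha> =
     {H \<in> hamiltonians W \<alpha>. \<forall>t. \<forall>x\<in>W. \<alpha> x (ham_vf W \<alpha> (H t) x) \<ge> 0}"

definition Symp ::
  "'a::euclidean_space set \<Rightarrow> ('a \<Rightarrow> 'a \<Rightarrow> real) \<Rightarrow> ('a \<Rightarrow> 'a) set" where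
  "Symp W \<alpha> = {\<psi>. bij_betw \<psi> W W \<and> smooth_on W \<psi> \<and> smooth_on W (inv_into W \<psi>) \<and>
     (\<forall>x\<in>W. \<forall>v. \<alpha> (\<psi> x) (diff_in W \<psi> x v) = \<alpha> x v)}"

text \<open>The infimum is taken in the extended reals, so that it is \<open>\<infinity>\<close> should no admissible constant
  exist.\<close>

definition dT ::
  "'a::euclidean_space set \<Rightarrow> ('a \<Rightarrow> 'a \<Rightarrow> real) \<Rightarrow> (real \<Rightarrow> 'a \<Rightarrow> real) \<Rightarrow> (real \<Rightarrow> 'a \<Rightarrow> real) \<Rightarrow> ereal" where
  "dT W \<alpha> H G = Inf {ereal (ln C) | C. C > 0 \<and> ln C \<ge> 0 \<and>
     (\<exists>\<phi>\<in>Symp W \<alpha>. \<forall>t. \<forall>x\<in>W. (1 / C) * H t x \<le> G t (\<phi> x) \<and> G t (\<phi> x) \<le> C * H t x)}"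

section \<open>The closed disc of area \<open>a\<close>\<close>

definition disc :: "real \<Rightarrow> complex set" where
  "disc a = {u. pi * (cmod u)\<^sup>2 \<le> a}"

text \<open>\<open>r\<^sup>2 d\<theta> / 2 = (x dy - y dx) / 2\<close>; the Cartesian form is also valid at the origin.\<close>

definition lambda_std :: "complex \<Rightarrow> complex \<Rightarrow> real" where
  "lambda_std z v = (Re z * Im v - Im z * Re v) / 2"

text \<open>Away from the origin \<open>d\<theta>\<close> is the imaginary part of \<open>dz / z\<close>.\<close>

lemma lambda_std_polar: "lambda_std z v = 1 / 2 * (cmod z)\<^sup>2 * Im (v / z)"
proof (cases "z = 0")
  case False
  then have "Im (v / z) = (Im v * Re z - Re v * Im z) / (cmod z)\<^sup>2"
    by (simp add: Im_divide cmod_power2)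
  with False show ?thesis
    by (simp add: lambda_std_def mult.commute)
qed (simp add: lambda_std_def)

end

theory Submission
  imports Defs
begin

text \<open>
  With \<open>s = \<pi> |z|\<^sup>2 / a\<close> take \<open>\<Phi> v = (1 - s) exp (- P\<^sub>v s)\<close>, where \<open>P\<^sub>v s = \<Sum>\<^sub>i v\<^sub>i s ^ m\<^sub>i + M s\<close> and
  \<open>M = \<Sum>\<^sub>i m\<^sub>i |v\<^sub>i|\<close>, so that \<open>P\<^sub>v\<close> is nondecreasing on \<open>[0, 1]\<close>. For a radial Hamiltonian \<open>h s\<close> one has
  \<open>\<lambda>(X) = - s h' s\<close>, which gives both positivity conditions.

  Let \<open>\<phi>\<close> preserve \<open>\<lambda>\<close>. Since \<open>\<lambda>\<close> vanishes along rays, \<open>\<phi>\<close> maps rays to rays, say \<open>\<phi> (t x) = q x \<phi> x\<close> for a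
  fixed \<open>t\<close>. Comparing the first-order behaviour in \<open>y\<close> near \<open>x\<close> of \<open>\<lambda>\<close> at \<open>\<phi> x\<close> on \<open>\<phi> y\<close> and of \<open>\<lambda>\<close> at
  \<open>\<phi> (t x)\<close> on \<open>\<phi> (t y)\<close> gives \<open>q\<^sup>2 = t\<^sup>2\<close>, so \<open>\<phi>\<close> is homogeneous (no second derivatives are needed);
  as it maps the disc bijectively to itself, \<open>|\<phi> z| = |z|\<close>. Therefore the distance between
  two radial Hamiltonians is the supremum of \<open>|ln H - ln G|\<close>, here of \<open>|P\<^sub>v - P\<^sub>w|\<close>. Monomials being linearly
  independent, this dominates the coefficients of \<open>P\<^sub>v - P\<^sub>w\<close>, with a constant not depending on \<open>a\<close>.
\<close>

section \<open>Maps preserving the Liouville form along rays\<close>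

lemma lambda_std_self [simp]: "lambda_std z z = 0"
  by (simp add: lambda_std_def)

lemma lambda_std_scaleR [simp]:
  "lambda_std (c *\<^sub>R z) v = c * lambda_std z v"
  "lambda_std z (c *\<^sub>R v) = c * lambda_std z v"
  by (simp_all add: lambda_std_def algebra_simps)

lemma lambda_std_rotate: "lambda_std z (\<i> * z) = (cmod z)\<^sup>2 / 2"
  by (simp only: lambda_std_def cmod_power2) (simp add: power2_eq_square)

lemma bounded_linear_lambda_std: "bounded_linear (lambda_std z)"
  unfolding linear_conv_bounded_linear[symmetric]
  by (rule linearI) (simp_all add: lambda_std_def field_simps)

lemma bounded_linear_lambda_std_left: "bounded_linear (\<lambda>z. lambda_std z v)"
  unfolding linear_conv_bounded_linear[symmetric]
  by (rule linearI) (simp_all add: lambda_std_def field_simps)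

lemma scaleR_mem_ball_0:
  fixes x :: "'a::real_normed_vector"
  assumes "x \<in> ball 0 R" "0 \<le> t" "t \<le> 1"
  shows "t *\<^sub>R x \<in> ball 0 R"
  using assms mult_left_le_one_le[of "norm x" t] by simp

text \<open>Since \<open>lambda_std (s x) x = 0\<close>, invariance makes the radial derivative of
  \<open>f\<close> at \<open>s x\<close> a real multiple of \<open>f (s x)\<close>, so the image of
  a ray stays on one real line through the origin.\<close>

lemma real_multiple_along_ray:
  fixes f :: "complex \<Rightarrow> complex"
  assumes der: "\<And>x. x \<in> ball 0 R \<Longrightarrow> (f has_derivative D x) (at x)"
    and pres: "\<And>x v. x \<in> ball 0 R \<Longrightarrow> lambda_std (f x) (D x v) = lambda_std x v"
    and nz: "\<And>x. x \<in> ball 0 R \<Longrightarrow> x \<noteq> 0 \<Longrightarrow> f x \<noteq> 0"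
    and x: "x \<in> ball 0 R" and t: "0 < t" "t \<le> 1"
  shows "f (t *\<^sub>R x) = Re (f (t *\<^sub>R x) / f x) *\<^sub>R f x"
proof (cases "x = 0")
  case False
  define g where "g s = f (s *\<^sub>R x)" for s :: real
  have inb: "s *\<^sub>R x \<in> ball 0 R" if "s \<in> {0<..1}" for s
    using scaleR_mem_ball_0[of x R s] x that by simp
  have gnz: "g s \<noteq> 0" if "s \<in> {0<..1}" for s
    using nz[OF inb[OF that]] that False by (simp add: g_def)
  have dg: "(g has_derivative (\<lambda>h. h *\<^sub>R D (s *\<^sub>R x) x)) (at s within {0<..1})" if s: "s \<in> {0<..1}" for s
  proof -
    have "((\<lambda>s. f (s *\<^sub>R x)) has_derivative (\<lambda>h. D (s *\<^sub>R x) (h *\<^sub>R x))) (at s within {0<..1})"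
      by (rule has_derivative_compose[where f="\<lambda>s. s *\<^sub>R x", OF _ der[OF inb[OF s]]])
        (auto intro!: derivative_eq_intros)
    then show ?thesis
      using bounded_linear.linear[OF has_derivative_bounded_linear[OF der[OF inb[OF s]]]]
      by (simp add: g_def[abs_def] linear_cmul)
  qed
  \<comment> \<open>\<open>g / cnj g\<close> is the square of the phase of \<open>g\<close>, which
    avoids a branch of the argument but leaves the sign of the real ratio open. The interval omits
    0, where \<open>g\<close> may vanish.\<close>
  have dq: "((\<lambda>s. g s / cnj (g s)) has_derivative (\<lambda>h. 0)) (at s within {0<..1})" if s: "s \<in> {0<..1}" for s
  proof -
    let ?w = "D (s *\<^sub>R x) x"
    have "lambda_std (g s) ?w = lambda_std (s *\<^sub>R x) x"
      using pres[OF inb[OF s]] by (simp add: g_def)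
    then have "Re (g s) * Im ?w = Im (g s) * Re ?w"
      by (simp add: lambda_std_def)
    then have eq: "?w * cnj (g s) = g s * cnj ?w"
      by (simp add: complex_eq_iff algebra_simps)
    have "((\<lambda>s. cnj (g s)) has_derivative (\<lambda>h. cnj (h *\<^sub>R ?w))) (at s within {0<..1})"
      by (rule bounded_linear.has_derivative[OF bounded_linear_cnj dg[OF s]])
    from has_derivative_divide'[OF dg[OF s] this] gnz[OF s]
    have "((\<lambda>s. g s / cnj (g s)) has_derivative
        (\<lambda>h. ((h *\<^sub>R ?w) * cnj (g s) - g s * cnj (h *\<^sub>R ?w)) / (cnj (g s) * cnj (g s)))) (at s within {0<..1})"
      by simp
    then show ?thesis by (simp add: eq flip: scaleR_diff_right)
  qed
  have "g t / cnj (g t) = g 1 / cnj (g 1)"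
    using has_derivative_zero_unique[OF _ dq] t
    by (metis greaterThanAtMost_iff convex_real_interval(6) order_refl zero_less_one)
  then have "g t * cnj (g 1) = cnj (g t) * g 1"
    using gnz[of t] gnz[of 1] t by (simp add: field_simps)
  then have "Im (g t / g 1) = 0"
    by (simp add: Im_divide complex_eq_iff algebra_simps)
  then have "g t / g 1 = of_real (Re (g t / g 1))"
    by (simp add: complex_eq_iff)
  then show ?thesis
    using gnz[of 1] unfolding g_def scaleR_conv_of_real
    by (metis divide_eq_eq greaterThanAtMost_iff mult_1 of_real_1 order_refl zero_less_one)
qed (cases "f 0 = 0"; simp)


lemma square_ratio_along_ray:
  fixes f :: "complex \<Rightarrow> complex"
  assumes der: "\<And>x. x \<in> ball 0 R \<Longrightarrow> (f has_derivative D x) (at x)"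
    and pres: "\<And>x v. x \<in> ball 0 R \<Longrightarrow> lambda_std (f x) (D x v) = lambda_std x v"
    and nz: "\<And>x. x \<in> ball 0 R \<Longrightarrow> x \<noteq> 0 \<Longrightarrow> f x \<noteq> 0"
    and x: "x \<in> ball 0 R" "x \<noteq> 0" and t: "0 < t" "t \<le> 1"
  shows "(Re (f (t *\<^sub>R x) / f x))\<^sup>2 = t\<^sup>2"
proof -
  define q where "q y = Re (f (t *\<^sub>R y) / f y)" for y
  \<comment> \<open>This direction is transverse to the ray: the form takes the nonzero value
    \<open>|x|^2 / 2\<close> on it.\<close>
  define v where "v = \<i> * x"
  define l where "l = lambda_std x v"
  have l: "l \<noteq> 0" using x by (simp add: l_def v_def lambda_std_rotate)
  have tx: "t *\<^sub>R x \<in> ball 0 R"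
    using scaleR_mem_ball_0[of x R t] x t by simp
  define y where "y h = x + h *\<^sub>R v" for h :: real
  have y0 [simp]: "y 0 = x" by (simp add: y_def)
  \<comment> \<open>Invariance turns the derivative into \<open>lambda_std (s x) (s v)\<close>: one
    factor \<open>s\<close> comes from the base point, the other from the velocity.\<close>
  have dL: "((\<lambda>h. lambda_std (f (s *\<^sub>R x)) (f (s *\<^sub>R y h))) has_derivative (\<lambda>h. h * (s\<^sup>2 * l))) (at 0)"
    if "s *\<^sub>R x \<in> ball 0 R" for s
  proof -
    have "((\<lambda>h. s *\<^sub>R y h) has_derivative (\<lambda>h. h *\<^sub>R (s *\<^sub>R v))) (at 0)"
      unfolding y_def by (auto intro!: derivative_eq_intros)
    moreover have "(f has_derivative D (s *\<^sub>R x)) (at (s *\<^sub>R y 0))"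
      using der[OF that] by simp
    ultimately have "((\<lambda>h. f (s *\<^sub>R y h)) has_derivative (\<lambda>h. D (s *\<^sub>R x) (h *\<^sub>R (s *\<^sub>R v)))) (at 0)"
      by (rule has_derivative_compose)
    from bounded_linear.has_derivative[OF bounded_linear_lambda_std this]
    have "((\<lambda>h. lambda_std (f (s *\<^sub>R x)) (f (s *\<^sub>R y h))) has_derivative
       (\<lambda>h. lambda_std (f (s *\<^sub>R x)) (D (s *\<^sub>R x) (h *\<^sub>R (s *\<^sub>R v))))) (at 0)" .
    then show ?thesis using pres[OF that] by (simp add: l_def power2_eq_square mult.assoc)
  qed
  define L where "L h = lambda_std (f x) (f (y h))" for h
  define M where "M h = lambda_std (f (t *\<^sub>R x)) (f (t *\<^sub>R y h))" for h
  have L: "((\<lambda>h. L h / h) \<longlongrightarrow> l) (at 0)"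
  proof -
    have "DERIV L 0 :> l"
      using dL[of 1] x unfolding L_def[abs_def] has_field_derivative_def by (simp add: mult_commute_abs)
    then show ?thesis by (simp add: DERIV_def L_def)
  qed
  have M: "((\<lambda>h. M h / h) \<longlongrightarrow> t\<^sup>2 * l) (at 0)"
  proof -
    have "DERIV M 0 :> t\<^sup>2 * l"
      using dL[of t] tx unfolding M_def[abs_def] has_field_derivative_def by (simp add: mult_commute_abs)
    then show ?thesis by (simp add: DERIV_def M_def)
  qed
  have cy: "isCont y 0" unfolding y_def by (intro continuous_intros)
  \<comment> \<open>Continuity of \<open>q\<close> suffices: \<open>L\<close> vanishes at 0, so
    \<open>L h / h\<close> alone carries the first-order information.\<close>
  have q: "((\<lambda>h. q (y h)) \<longlongrightarrow> q x) (at 0)"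
  proof -
    have "isCont f x" "isCont f (t *\<^sub>R x)"
      using der[OF x(1)] der[OF tx] has_derivative_continuous by blast+
    then have "isCont (\<lambda>h. f (y h)) 0" "isCont (\<lambda>h. f (t *\<^sub>R y h)) 0"
      using isCont_o2[of 0 y f] isCont_o2[of 0 "\<lambda>h. t *\<^sub>R y h" f] cy by (auto intro!: continuous_intros)
    then have "isCont (\<lambda>h. f (t *\<^sub>R y h) / f (y h)) 0"
      using nz[OF x] by (intro isCont_divide) simp_all
    then have "isCont (\<lambda>h. q (y h)) 0"
      unfolding q_def by (rule continuous_Re)
    then show ?thesis by (simp add: isCont_def)
  qed
  have "eventually (\<lambda>h. y h \<in> ball 0 R) (at 0)"
    using cy x by (intro topological_tendstoD) (auto simp: isCont_def)
  then have "eventually (\<lambda>h. q x * q (y h) * (L h / h) = M h / h) (at 0)"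
  proof eventually_elim
    case (elim h)
    have "M h = lambda_std (q x *\<^sub>R f x) (q (y h) *\<^sub>R f (y h))"
      unfolding M_def q_def
      using real_multiple_along_ray[OF der pres nz elim t] real_multiple_along_ray[OF der pres nz x(1) t]
      by simp
    then show ?case by (simp add: L_def)
  qed
  moreover have "((\<lambda>h. q x * q (y h) * (L h / h)) \<longlongrightarrow> q x * q x * l) (at 0)"
    by (intro tendsto_intros q L)
  ultimately have "((\<lambda>h. M h / h) \<longlongrightarrow> q x * q x * l) (at 0)"
    by (blast intro: Lim_transform_eventually)
  with M have "t\<^sup>2 * l = q x * q x * l"
    by (intro tendsto_unique[OF trivial_limit_at])
  then show ?thesis using l by (simp add: q_def power2_eq_square)
qed

text \<open>It remains to exclude \<open>q t = - t\<close>. On \<open>[t, 1]\<close> the continuous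
  function \<open>q\<close> has no zero, because \<open>(q s)^2 = s^2\<close>, and
  \<open>q 1 = 1\<close>, so it stays positive.\<close>

lemma homogeneous_in_ball:
  fixes f :: "complex \<Rightarrow> complex"
  assumes der: "\<And>x. x \<in> ball 0 R \<Longrightarrow> (f has_derivative D x) (at x)"
    and pres: "\<And>x v. x \<in> ball 0 R \<Longrightarrow> lambda_std (f x) (D x v) = lambda_std x v"
    and nz: "\<And>x. x \<in> ball 0 R \<Longrightarrow> x \<noteq> 0 \<Longrightarrow> f x \<noteq> 0"
    and x: "x \<in> ball 0 R" "x \<noteq> 0" and t: "0 < t" "t \<le> 1"
  shows "f (t *\<^sub>R x) = t *\<^sub>R f x"
proof -
  define q where "q s = Re (f (s *\<^sub>R x) / f x)" for s
  have fx: "f x \<noteq> 0" using nz x by blast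
  have q2: "(q s)\<^sup>2 = s\<^sup>2" if "s \<in> {t..1}" for s
    using square_ratio_along_ray[OF der pres nz x, of s] that t by (simp add: q_def)
  have "continuous_on {t..1} q"
  proof -
    have "(\<lambda>s. s *\<^sub>R x) ` {t..1} \<subseteq> ball 0 R"
      using scaleR_mem_ball_0[OF x(1)] t by (simp add: image_subset_iff)
    moreover have "continuous_on (ball 0 R) f"
      using der has_derivative_continuous continuous_at_imp_continuous_on by blast
    ultimately have "continuous_on {t..1} (\<lambda>s. f (s *\<^sub>R x))"
      by (intro continuous_on_compose2[of "ball 0 R" f "{t..1}" "\<lambda>s. s *\<^sub>R x"] continuous_intros)
    then show ?thesis unfolding q_def using fx by (intro continuous_intros) auto
  qed
  moreover have "q 1 = 1" using fx by (simp add: q_def)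
  ultimately have "q t > 0"
    using IVT'[of q t 0 1] q2 t by (smt (verit) atLeastAtMost_iff power_zero_numeral zero_less_power)
  then have "q t = t" using q2[of t] t by (simp add: power2_eq_iff)
  then show ?thesis
    using real_multiple_along_ray[OF der pres nz x(1) t] by (simp add: q_def)
qed

section \<open>The disc\<close>

lemma disc_eq_cball:
  assumes "a > 0"
  shows "disc a = cball 0 (sqrt (a / pi))"
proof -
  have "pi * (cmod u)\<^sup>2 \<le> a \<longleftrightarrow> cmod u \<le> sqrt (a / pi)" for u
  proof -
    have "pi * (cmod u)\<^sup>2 \<le> a \<longleftrightarrow> (cmod u)\<^sup>2 \<le> a / pi"
      by (simp add: field_simps)
    also have "\<dots> \<longleftrightarrow> sqrt ((cmod u)\<^sup>2) \<le> sqrt (a / pi)"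
      by (simp only: real_sqrt_le_iff)
    finally show ?thesis by simp
  qed
  then show ?thesis by (simp add: disc_def cball_def)
qed

section \<open>Derivatives within the closed disc\<close>

text \<open>Needed on the boundary circle, where \<open>frechet_derivative\<close> could otherwise
  pick any candidate. Restriction to segments shows that two derivatives agree on all
  \<open>y - x\<close> with \<open>y\<close> in \<open>S\<close>, and these vectors span because
  \<open>S\<close> contains a ball.\<close>

lemma frechet_derivative_unique_within_convex:
  fixes f :: "'a::real_normed_vector \<Rightarrow> 'b::real_normed_vector"
  assumes f': "(f has_derivative f') (at x within S)"
    and f'': "(f has_derivative f'') (at x within S)"
    and S: "convex S" "interior S \<noteq> {}" and x: "x \<in> S"
  shows "f' = f''"
proof -
  have l: "linear f'" "linear f''"
    by (fact has_derivative_linear[OF f'], fact has_derivative_linear[OF f''])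
  have eq: "f' (y - x) = f'' (y - x)" if y: "y \<in> S" for y
  proof -
    have *: "((\<lambda>t. f (x + t *\<^sub>R (y - x))) has_vector_derivative g (y - x)) (at 0 within {0..1})"
      if g: "(f has_derivative g) (at x within S)" for g
    proof -
      have "(\<lambda>t. x + t *\<^sub>R (y - x)) ` {0..1} \<subseteq> S"
        using S(1) x y by (auto simp: convex_alt algebra_simps)
      then have "(f has_derivative g) (at (x + 0 *\<^sub>R (y - x)) within (\<lambda>t. x + t *\<^sub>R (y - x)) ` {0..1})"
        using has_derivative_subset[OF g] by simp
      moreover have "((\<lambda>t. x + t *\<^sub>R (y - x)) has_derivative (\<lambda>t. t *\<^sub>R (y - x))) (at 0 within {0..1})"
        by (auto intro!: derivative_eq_intros)
      ultimately have "((\<lambda>t. f (x + t *\<^sub>R (y - x))) has_derivative (\<lambda>t. g (t *\<^sub>R (y - x)))) (at 0 within {0..1})"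
        by (rule has_derivative_in_compose[rotated])
      then show ?thesis
        using has_derivative_linear[OF g] by (simp add: has_vector_derivative_def linear_cmul)
    qed
    show ?thesis
      by (rule vector_derivative_unique_within[OF _ *[OF f'] *[OF f'']]) (simp add: trivial_limit_within)
  qed
  obtain z e where e: "e > 0" "ball z e \<subseteq> S"
    using S(2) by (meson all_not_in_conv mem_interior)
  show "f' = f''"
  proof
    fix v
    show "f' v = f'' v"
    proof (cases "v = 0")
      case False
      \<comment> \<open>This size keeps \<open>z + c v\<close> in the ball around \<open>z\<close>.
        Subtracting the equalities at the two points removes \<open>x\<close> and leaves
        \<open>c v\<close>.\<close>
      define c where "c = e / (2 * norm v)"
      have c: "c \<noteq> 0" using e False by (simp add: c_def)
      have "z \<in> S" "z + c *\<^sub>R v \<in> S"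
        using e False by (auto simp: c_def dist_norm intro!: subsetD[OF e(2)])
      from eq[OF this(1)] eq[OF this(2)]
      have "f' ((z + c *\<^sub>R v - x) - (z - x)) = f'' ((z + c *\<^sub>R v - x) - (z - x))"
        using l by (simp only: linear_diff)
      then show ?thesis using l c by (simp add: linear_cmul)
    qed (use l in \<open>simp add: linear_0\<close>)
  qed
qed


lemma diff_in_disc:
  assumes "a > 0" "x \<in> disc a" "(f has_derivative D) (at x within disc a)"
  shows "diff_in (disc a) f x = D"
proof -
  have "(f has_derivative diff_in (disc a) f x) (at x within disc a)"
    using assms(3) unfolding diff_in_def by (metis differentiableI frechet_derivative_works)
  then show ?thesis
    using assms by (intro frechet_derivative_unique_within_convex[of f _ x "disc a"])
      (auto simp: disc_eq_cball not_le)
qed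

section \<open>Symplectomorphisms of the disc\<close>

lemma smooth_on_imp_differentiable_within:
  assumes "smooth_on S f" "x \<in> S"
  shows "f differentiable (at x within S)"
proof -
  obtain U g where U: "open U" "x \<in> U" and g: "\<And>k. Ck_on k U g" and eq: "\<And>y. y \<in> U \<inter> S \<Longrightarrow> g y = f y"
    using assms(1)[unfolded smooth_on_def, rule_format, OF assms(2)] by blast
  have "g differentiable (at x)" using g[of "Suc 0"] U by simp
  then obtain D where "(g has_derivative D) (at x within S)"
    unfolding differentiable_def using has_derivative_at_withinI by blast
  moreover have "\<forall>\<^sub>F y in at x within S. g y = f y"
    using U by (auto simp: eventually_at_topological intro!: exI[of _ U] eq)
  ultimately have "(f has_derivative D) (at x within S)"
    by (rule has_derivative_transform_eventually) (use eq[of x] U assms(2) in simp_all)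
  then show ?thesis unfolding differentiable_def by blast
qed

lemma Symp_disc_pullback:
  assumes \<phi>: "\<phi> \<in> Symp (disc a) lambda_std" and y: "y \<in> disc a"
  shows "(\<phi> has_derivative diff_in (disc a) \<phi> y) (at y within disc a)"
    and "lambda_std (\<phi> y) (diff_in (disc a) \<phi> y v) = lambda_std y v"
proof -
  have "smooth_on (disc a) \<phi>" using \<phi> by (simp add: Symp_def)
  from smooth_on_imp_differentiable_within[OF this y]
  show "(\<phi> has_derivative diff_in (disc a) \<phi> y) (at y within disc a)"
    unfolding diff_in_def by (simp add: frechet_derivative_works)
  show "lambda_std (\<phi> y) (diff_in (disc a) \<phi> y v) = lambda_std y v"
    using \<phi> y by (simp add: Symp_def)
qed

text \<open>At a zero \<open>z\<close> of \<open>\<phi>\<close> the pullback identity on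
  \<open>\<i> * z\<close> reads \<open>0 = |z|^2 / 2\<close>, so only the origin can be a zero;
  surjectivity provides one.\<close>

lemma Symp_disc_eq_0_iff:
  assumes a: "a > 0" and \<phi>: "\<phi> \<in> Symp (disc a) lambda_std" and y: "y \<in> disc a"
  shows "\<phi> y = 0 \<longleftrightarrow> y = 0"
proof -
  have nz: "z = 0" if "z \<in> disc a" "\<phi> z = 0" for z
    using Symp_disc_pullback(2)[OF \<phi> that(1), of "\<i> * z"] lambda_std_rotate[of z] that(2)
    by (auto simp: lambda_std_def)
  have "0 \<in> disc a" using a by (simp add: disc_def)
  then obtain z where "z \<in> disc a" "\<phi> z = 0"
    using \<phi> unfolding Symp_def bij_betw_def by (metis (mono_tags, lifting) imageE mem_Collect_eq)
  then show ?thesis using nz y by blast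
qed

text \<open>The ray argument runs in the open ball, where derivatives are two-sided; continuity
  carries the identity to the boundary circle.\<close>

lemma Symp_disc_homogeneous:
  assumes a: "a > 0" and \<phi>: "\<phi> \<in> Symp (disc a) lambda_std"
    and x: "x \<in> disc a" and t: "0 < t" "t \<le> 1"
  shows "\<phi> (t *\<^sub>R x) = t *\<^sub>R \<phi> x"
proof -
  define R where "R = sqrt (a / pi)"
  have disc: "disc a = cball 0 R" and R: "R > 0"
    using a by (simp_all add: disc_eq_cball R_def)
  define D where "D y = diff_in (disc a) \<phi> y" for y
  note D = Symp_disc_pullback(1)[OF \<phi>, folded D_def]
  note pres = Symp_disc_pullback(2)[OF \<phi>, folded D_def]
  note eq_0 = Symp_disc_eq_0_iff[OF a \<phi>]
  have Dball: "(\<phi> has_derivative D y) (at y)" if "y \<in> ball 0 R" for y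
  proof -
    have "at y within disc a = at y" using that by (intro at_within_interior) (simp add: disc)
    moreover have "y \<in> disc a" using that by (simp add: disc)
    ultimately show ?thesis using D[of y] by simp
  qed
  have cont: "continuous_on (cball 0 R) \<phi>"
    using has_derivative_continuous[OF D] by (simp add: continuous_on_eq_continuous_within disc)
  have "(\<lambda>y. t *\<^sub>R y) ` cball 0 R \<subseteq> cball (0::complex) R"
  proof (rule image_subsetI)
    fix y :: complex assume "y \<in> cball 0 R"
    then show "t *\<^sub>R y \<in> cball 0 R" using t mult_left_le_one_le[of "norm y" t] by simp
  qed
  then have "continuous_on (cball 0 R) (\<lambda>y. \<phi> (t *\<^sub>R y) - t *\<^sub>R \<phi> y)"
    by (intro continuous_intros continuous_on_compose2[OF cont] cont)
  then have cont': "continuous_on (closure (ball 0 R)) (\<lambda>y. \<phi> (t *\<^sub>R y) - t *\<^sub>R \<phi> y)"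
    using R by simp
  have "\<phi> (t *\<^sub>R y) - t *\<^sub>R \<phi> y = 0" if y: "y \<in> ball 0 R" for y
  proof (cases "y = 0")
    case True
    then show ?thesis using eq_0[of 0] R by (simp add: disc)
  next
    case False
    have "\<phi> (t *\<^sub>R y) = t *\<^sub>R \<phi> y"
    proof (rule homogeneous_in_ball[OF Dball _ _ y False t])
      fix z :: complex assume "z \<in> ball 0 R"
      then have z: "z \<in> disc a" by (simp add: disc)
      show "lambda_std (\<phi> z) (D z v) = lambda_std z v" for v by (rule pres[OF z])
      show "\<phi> z \<noteq> 0" if "z \<noteq> 0" using that eq_0[OF z] by simp
    qed
    then show ?thesis by simp
  qed
  from continuous_constant_on_closure[OF cont' this, of x]
  show ?thesis using x R by (simp add: disc)
qed

text \<open>A nonzero \<open>y\<close> is \<open>t z\<close> with \<open>z\<close> on the boundary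
  circle and \<open>t = |y| / R\<close>, so \<open>|\<phi> z| \<le> R\<close> scales to
  \<open>|\<phi> y| \<le> |y|\<close>. The reverse bound is the same argument for preimages.\<close>

lemma norm_Symp_disc:
  assumes a: "a > 0" and \<phi>: "\<phi> \<in> Symp (disc a) lambda_std" and x: "x \<in> disc a"
  shows "cmod (\<phi> x) = cmod x"
proof -
  define R where "R = sqrt (a / pi)"
  have disc: "disc a = cball 0 R" and R: "R > 0"
    using a by (simp_all add: disc_eq_cball R_def)
  have bij: "bij_betw \<phi> (cball 0 R) (cball 0 R)" using \<phi> by (simp add: Symp_def disc)
  have hom: "\<phi> (t *\<^sub>R y) = t *\<^sub>R \<phi> y" if "y \<in> cball 0 R" "0 < t" "t \<le> 1" for t y
    using Symp_disc_homogeneous[OF a \<phi>] that disc by simp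
  have maps: "\<phi> y \<in> cball 0 R" if "y \<in> cball 0 R" for y
    using bij that bij_betwE by blast
  note eq_0 = Symp_disc_eq_0_iff[OF a \<phi>, unfolded disc]
  have le: "cmod (\<phi> y) \<le> cmod y" if "y \<in> cball 0 R" "y \<noteq> 0" for y
  proof -
    define t where "t = cmod y / R"
    have t: "0 < t" "t \<le> 1" using that R by (simp_all add: t_def)
    define z where "z = (1 / t) *\<^sub>R y"
    have z: "z \<in> cball 0 R" "z \<noteq> 0" "y = t *\<^sub>R z"
      using that R t by (simp_all add: z_def) (simp_all add: t_def)
    have "cmod (\<phi> y) = t * cmod (\<phi> z)" using hom[OF z(1) t] z(3) t by simp
    also have "\<dots> \<le> t * R" using maps[OF z(1)] t by simp
    finally show ?thesis using R by (simp add: t_def)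
  qed
  have ge: "cmod y \<le> cmod (\<phi> y)" if y: "y \<in> cball 0 R" "y \<noteq> 0" for y
  proof -
    define t where "t = cmod (\<phi> y) / R"
    have t: "0 < t" "t \<le> 1" using maps[OF y(1)] eq_0[of y] y R by (simp_all add: t_def)
    \<comment> \<open>The boundary point on the ray through \<open>\<phi> y\<close>. Homogeneity is
      applied at its preimage \<open>z\<close>, and injectivity then identifies \<open>y\<close>
      with \<open>t z\<close>.\<close>
    define w where "w = (1 / t) *\<^sub>R \<phi> y"
    have "w \<in> cball 0 R" "w \<noteq> 0" and w: "\<phi> y = t *\<^sub>R w"
      using eq_0[of y] y R t by (simp_all add: w_def) (simp_all add: t_def)
    then have "w \<in> \<phi> ` cball 0 R" using bij by (simp only: bij_betw_def)
    then obtain z where z: "z \<in> cball 0 R" "w = \<phi> z" by (rule imageE)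
    have "\<phi> (t *\<^sub>R z) = \<phi> y" using hom[OF z(1) t] w z by simp
    moreover have "t *\<^sub>R z \<in> cball 0 R" using z t mult_left_le_one_le[of "norm z" t] by simp
    ultimately have "y = t *\<^sub>R z" using bij y unfolding bij_betw_def inj_on_def by blast
    then have "cmod y = t * cmod z" using t by simp
    also have "\<dots> \<le> t * R" using z t by simp
    finally show ?thesis using R by (simp add: t_def)
  qed
  show ?thesis
    using le ge eq_0 x disc by (metis antisym norm_zero)
qed

section \<open>Radial Hamiltonians\<close>

lemma real_polynomial_function_derivative:
  assumes "real_polynomial_function (p :: 'a::real_normed_vector \<Rightarrow> real)"
  shows "\<exists>D. (\<forall>x. (p has_derivative D x) (at x)) \<and> (\<forall>v. real_polynomial_function (\<lambda>x. D x v))"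
  using assms
proof induction
  case (linear f)
  then show ?case
    using bounded_linear_imp_has_derivative
    by (intro exI[of _ "\<lambda>x. f"]) (auto intro: real_polynomial_function.intros(2))
next
  case (const c)
  show ?case by (intro exI[of _ "\<lambda>x v. 0"]) (auto intro: real_polynomial_function.intros(2))
next
  case (add f g)
  then obtain D E where
    "\<And>x. (f has_derivative D x) (at x)" "\<And>v. real_polynomial_function (\<lambda>x. D x v)"
    "\<And>x. (g has_derivative E x) (at x)" "\<And>v. real_polynomial_function (\<lambda>x. E x v)"
    by blast
  then show ?case
    by (intro exI[of _ "\<lambda>x v. D x v + E x v"])
      (auto intro: has_derivative_add real_polynomial_function.intros(3))
next
  case (mult f g)
  then obtain D E where
    "\<And>x. (f has_derivative D x) (at x)" "\<And>v. real_polynomial_function (\<lambda>x. D x v)"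
    "\<And>x. (g has_derivative E x) (at x)" "\<And>v. real_polynomial_function (\<lambda>x. E x v)"
    by blast
  with mult.hyps show ?case
    by (intro exI[of _ "\<lambda>x v. f x * E x v + D x v * g x"])
      (auto intro!: has_derivative_mult real_polynomial_function.intros(3) real_polynomial_function.intros(4))
qed

text \<open>The functions \<open>p exp q\<close> with polynomials \<open>p\<close> and \<open>q\<close>, for fixed \<open>q\<close>, are closed under
  directional derivatives.\<close>

lemma Ck_on_polynomial_exp:
  assumes q: "real_polynomial_function (q :: 'a::real_normed_vector \<Rightarrow> real)"
    and p: "real_polynomial_function p"
  shows "Ck_on k UNIV (\<lambda>x. p x * exp (q x))"
  using p
proof (induction k arbitrary: p)
  case 0
  have "isCont p x" "isCont q x" for x
    using real_polynomial_function_derivative[OF q] real_polynomial_function_derivative[OF 0]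
      has_derivative_continuous by blast+
  then show ?case by (simp add: continuous_on_eq_continuous_at)
next
  case (Suc k)
  obtain D E where D: "\<And>x. (p has_derivative D x) (at x)" "\<And>v. real_polynomial_function (\<lambda>x. D x v)"
    and E: "\<And>x. (q has_derivative E x) (at x)" "\<And>v. real_polynomial_function (\<lambda>x. E x v)"
    using real_polynomial_function_derivative[OF q] real_polynomial_function_derivative[OF Suc.prems]
    by blast
  have der: "((\<lambda>x. p x * exp (q x)) has_derivative (\<lambda>v. (D x v + p x * E x v) * exp (q x))) (at x)" for x
    using has_derivative_mult[OF D(1) has_derivative_exp[OF E(1)], of x]
    by (simp add: algebra_simps)
  have "Ck_on k UNIV (\<lambda>x. (D x v + p x * E x v) * exp (q x))" for v
    using D(2) E(2) Suc.prems by (intro Suc.IH real_polynomial_function.intros(3,4))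
  moreover have "frechet_derivative (\<lambda>x. p x * exp (q x)) (at x) = (\<lambda>v. (D x v + p x * E x v) * exp (q x))" for x
    using frechet_derivative_at[OF der] by simp
  moreover have "(\<lambda>x. p x * exp (q x)) differentiable (at x)" for x
    using der differentiable_def by blast
  ultimately show ?case by simp
qed

section \<open>Hamiltonian vector fields and the two positivity conditions\<close>

text \<open>As a bilinear form the exterior derivative is \<open>2 * lambda_std\<close>, the area
  form. By antisymmetry the Liouville form at \<open>x\<close> on the Hamiltonian vector is minus
  half of that area form on the pair of this vector and \<open>x\<close>.\<close>

lemma ham_vf_disc:
  assumes a: "a > 0" and x: "x \<in> disc a" and h: "(h has_derivative D) (at x within disc a)"
  shows "lambda_std x (ham_vf (disc a) lambda_std h x) = - D x / 2"
proof -
  have "ext_deriv (disc a) lambda_std x u v = 2 * lambda_std u v" for u v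
  proof -
    have "diff_in (disc a) (\<lambda>y. lambda_std y w) x = (\<lambda>y. lambda_std y w)" for w
      by (intro diff_in_disc a x bounded_linear_imp_has_derivative bounded_linear_lambda_std_left)
    then show ?thesis unfolding ext_deriv_def by (simp add: lambda_std_def field_simps)
  qed
  moreover have "diff_in (disc a) h x = D"
    by (intro diff_in_disc a x h)
  ultimately have ham: "ham_vf (disc a) lambda_std h x = (THE X. \<forall>v. 2 * lambda_std X v = D v)"
    by (simp add: ham_vf_def)
  have lin: "linear D" using h by (rule has_derivative_linear)
  \<comment> \<open>The area form of \<open>X\<close> with \<open>1\<close> and with
    \<open>\<i>\<close> is \<open>- Im X\<close> and \<open>Re X\<close>, which dictates the
    coordinates.\<close>
  define X where "X = Complex (D \<i>) (- D 1)"
  have X: "2 * lambda_std X v = D v" for v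
  proof -
    have "D v = D (Re v *\<^sub>R 1 + Im v *\<^sub>R \<i>)" by (rule arg_cong[where f=D]) (simp add: complex_eq_iff)
    also have "\<dots> = Re v * D 1 + Im v * D \<i>"
      using lin by (simp only: linear_add linear_cmul) simp
    finally show ?thesis by (simp add: X_def lambda_std_def)
  qed
  have "(THE X. \<forall>v. 2 * lambda_std X v = D v) = X"
  proof (rule the_equality)
    fix Y assume "\<forall>v. 2 * lambda_std Y v = D v"
    then have "lambda_std Y v = lambda_std X v" for v using X[of v] by (metis mult_cancel_left zero_neq_numeral)
    from this[of 1] this[of \<i>] show "Y = X" by (simp add: lambda_std_def complex_eq_iff)
  qed (use X in blast)
  then have "lambda_std x (ham_vf (disc a) lambda_std h x) = - lambda_std X x"
    using ham by (simp add: lambda_std_def field_simps)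
  then show ?thesis using X[of x] by simp
qed

lemma radial_in_hamiltonians_plus:
  assumes a: "a > 0"
    and P: "real_polynomial_function (P :: real \<Rightarrow> real)"
    and der: "\<And>s. (P has_real_derivative P' s) (at s)"
    and nonneg: "\<And>s. 0 \<le> s \<Longrightarrow> s \<le> 1 \<Longrightarrow> 0 \<le> P' s"
    and s_def: "\<And>z. s z = pi / a * (cmod z)\<^sup>2"
  shows "(\<lambda>t z. (1 - s z) * exp (- P (s z))) \<in> hamiltonians_plus (disc a) lambda_std"
proof -
  define h where "h z = (1 - s z) * exp (- P (s z))" for z
  \<comment> \<open>This is \<open>- s\<close> times the derivative of the radial profile: the
    derivative of \<open>s\<close> at \<open>z\<close> along \<open>z\<close> is \<open>2 s\<close>,
    and the 2 cancels the half in \<open>ham_vf_disc\<close>.\<close>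
  define k where "k z = s z * (1 + (1 - s z) * P' (s z)) * exp (- P (s z))" for z
  have s01: "0 \<le> s z" "s z \<le> 1" if "z \<in> disc a" for z
    using that a by (simp_all add: s_def disc_def field_simps)
  have s_inner: "s z = pi / a * (z \<bullet> z)" for z
    by (simp add: s_def power2_norm_eq_inner)
  have ds: "(s has_derivative (\<lambda>v. 2 * pi / a * (z \<bullet> v))) (at z)" for z
    unfolding s_inner using a by (auto intro!: derivative_eq_intros simp: inner_commute)
  have dh: "(h has_derivative (\<lambda>v. - (2 * pi / a * (z \<bullet> v)) * (1 + (1 - s z) * P' (s z)) * exp (- P (s z)))) (at z)" for z
  proof -
    have "((\<lambda>s. (1 - s) * exp (- P s)) has_real_derivative - (1 + (1 - s z) * P' (s z)) * exp (- P (s z))) (at (s z))"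
      by (auto intro!: derivative_eq_intros der simp: algebra_simps)
    from has_derivative_compose[OF ds this[unfolded has_field_derivative_def]] show ?thesis
      by (simp add: h_def[abs_def] algebra_simps add_divide_distrib)
  qed
  have lam: "lambda_std z (ham_vf (disc a) lambda_std h z) = k z" if "z \<in> disc a" for z
    using ham_vf_disc[OF a that has_derivative_at_withinI[OF dh]]
    by (simp add: k_def s_inner)
  have k: "0 \<le> k z" "0 < k z + h z" if "z \<in> disc a" for z
  proof -
    note 1 = s01[OF that]
    then have 2: "0 \<le> (1 - s z) * P' (s z)" using nonneg[OF 1] by simp
    then show "0 \<le> k z" using 1 by (simp add: k_def)
    \<comment> \<open>The terms \<open>s\<close> and \<open>1 - s\<close> add up to 1, which gives
      strict positivity at the origin and on the boundary too.\<close>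
    have "k z + h z = (1 + s z * ((1 - s z) * P' (s z))) * exp (- P (s z))"
      by (simp add: k_def h_def algebra_simps)
    also have "\<dots> > 0" using mult_nonneg_nonneg[OF 1(1) 2] by (intro mult_pos_pos add_pos_nonneg) simp_all
    finally show "0 < k z + h z" .
  qed
  have fr: "h z = 0" if "z \<in> frontier (disc a)" for z
  proof -
    have "cmod z = sqrt (a / pi)" using that a by (simp add: disc_eq_cball)
    then have "s z = 1" using a by (simp add: s_def)
    then show ?thesis by (simp add: h_def)
  qed
  have smooth: "smooth_on (UNIV \<times> disc a) (\<lambda>(t::real, z). h z)"
  proof -
    have "real_polynomial_function (\<lambda>y::real \<times> complex. Re (snd y))"
      "real_polynomial_function (\<lambda>y::real \<times> complex. Im (snd y))"
      by (intro real_polynomial_function.intros(1) bounded_linear_compose[OF bounded_linear_Re bounded_linear_snd]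
        bounded_linear_compose[OF bounded_linear_Im bounded_linear_snd])+
    then have "real_polynomial_function (\<lambda>y::real \<times> complex. pi / a * ((Re (snd y))\<^sup>2 + (Im (snd y))\<^sup>2))"
      by (intro real_polynomial_function.intros(4) real_polynomial_function.intros(2) real_polynomial_function.intros(3)
        real_polynomial_function_power)
    then have s: "real_polynomial_function (\<lambda>y::real \<times> complex. s (snd y))"
      by (simp add: s_def cmod_power2)
    have "real_polynomial_function (\<lambda>y::real \<times> complex. 1 - s (snd y))"
      by (intro real_polynomial_function_diff real_polynomial_function.intros(2) s)
    moreover have "real_polynomial_function (\<lambda>y::real \<times> complex. - P (s (snd y)))"
      using real_polynomial_function_compose[OF s[unfolded real_polynomial_function_eq] P]
      by (intro real_polynomial_function_minus) (simp add: o_def)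
    ultimately have "Ck_on k UNIV (\<lambda>y::real \<times> complex. h (snd y))" for k
      unfolding h_def by (rule Ck_on_polynomial_exp[rotated])
    \<comment> \<open>The formula is smooth on the whole product space, so it serves as its own
      extension.\<close>
    then show ?thesis
      unfolding smooth_on_def by (intro ballI exI[of _ UNIV] exI[of _ "\<lambda>y. h (snd y)"]) auto
  qed
  have "(\<lambda>t. h) \<in> hamiltonians_plus (disc a) lambda_std"
    unfolding hamiltonians_plus_def hamiltonians_def tau_def
    using smooth fr k lam by (auto intro!: exI[of _ UNIV])
  then show ?thesis by (simp add: h_def[abs_def])
qed

section \<open>Separation by evaluation of polynomials\<close>

text \<open>The points \<open>1 / (m p + 1)\<close> and \<open>0\<close> are too many zeros for a nonzero combination of the
  monomials \<open>x ^ m p\<close>.\<close>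

lemma monomial_evaluation_bounded_below:
  fixes m :: "'k::finite \<Rightarrow> nat"
  assumes "inj m" and m: "\<And>p. m p \<in> {1..CARD('k)}"
  obtains B where "B > 0"
    "\<And>c :: real ^ 'k. B * norm c \<le> (\<Sum>p\<in>UNIV. \<bar>\<Sum>j\<in>UNIV. c $ j * (1 / real (m p + 1)) ^ m j\<bar>)"
proof -
  define x where "x p = 1 / real (m p + 1)" for p
  define T :: "real ^ 'k \<Rightarrow> real ^ 'k" where "T c = (\<chi> p. \<Sum>j\<in>UNIV. c $ j * x p ^ m j)" for c
  have lin: "linear T"
    by (rule linearI)
      (simp_all add: T_def vec_eq_iff sum.distrib sum_distrib_left algebra_simps)
  have inj: "inj T"
  proof (subst linear_injective_0[OF lin], intro allI impI)
    fix c assume "T c = 0"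
    define f where "f = (\<Sum>j\<in>UNIV. monom (c $ j) (m j))"
    have poly_f: "poly f y = (\<Sum>j\<in>UNIV. c $ j * y ^ m j)" for y
      by (simp add: f_def poly_sum poly_monom)
    have "poly f (x p) = 0" for p
      using \<open>T c = 0\<close> by (simp add: T_def poly_f vec_eq_iff)
    \<comment> \<open>All exponents are at least 1, so 0 is one more root; with it the number of
      roots exceeds the degree bound \<open>CARD('k)\<close>.\<close>
    moreover have "poly f 0 = 0"
      unfolding poly_f using m by (intro sum.neutral ballI) (simp add: Suc_le_eq)
    ultimately have roots: "insert 0 (range x) \<subseteq> {y. poly f y = 0}" by auto
    have "inj x" using \<open>inj m\<close> by (auto simp: inj_def x_def)
    then have card: "card (insert 0 (range x)) = Suc CARD('k)"
      using card_image[of x UNIV] by (subst card_insert_disjoint) (auto simp: x_def)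
    have "f = 0"
    proof (rule ccontr)
      assume f: "f \<noteq> 0"
      then have "Suc CARD('k) \<le> card {y. poly f y = 0}"
        using card_mono[OF poly_roots_finite roots] card by simp
      also have "\<dots> \<le> degree f" by (rule card_poly_roots_bound[OF f])
      also have "degree f \<le> CARD('k)"
        unfolding f_def
      proof (rule degree_sum_le)
        show "degree (monom (c $ j) (m j)) \<le> CARD('k)" for j
          using degree_monom_le[of "c $ j" "m j"] m[of j] by simp
      qed simp
      finally show False by simp
    qed
    have "c $ j = coeff f (m j)" for j
    proof -
      have "coeff f (m j) = (\<Sum>i\<in>UNIV. if i = j then c $ i else 0)"
        unfolding f_def coeff_sum
        using \<open>inj m\<close> by (intro sum.cong) (auto simp: inj_eq)
      then show ?thesis by simp
    qed
    with \<open>f = 0\<close> show "c = 0" by (simp add: vec_eq_iff)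
  qed
  obtain B where "B > 0" and B: "\<And>c. B * norm c \<le> norm (T c)"
    using linear_inj_bounded_below_pos[OF lin inj] by blast
  have "norm (T c) \<le> (\<Sum>p\<in>UNIV. \<bar>T c $ p\<bar>)" for c
    by (rule norm_le_l1_cart)
  then have "B * norm c \<le> (\<Sum>p\<in>UNIV. \<bar>\<Sum>j\<in>UNIV. c $ j * (1 / real (m p + 1)) ^ m j\<bar>)" for c
    using B[of c] by (simp add: T_def x_def) (meson order_trans)
  with \<open>B > 0\<close> show thesis by (rule that)
qed

section \<open>Lower bounds for the Thompson-type distance\<close>

text \<open>Symplectomorphisms enter only through norm preservation, which is all that radial
  functions see. A bound on every admissible \<open>ln C\<close> bounds the infimum, also when no
  \<open>C\<close> is admissible.\<close>

lemma le_dT_disc: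
  assumes a: "a > 0"
    and HG: "\<And>C \<phi>. C > 0 \<Longrightarrow> \<forall>x\<in>disc a. cmod (\<phi> x) = cmod x \<Longrightarrow>
      \<forall>t. \<forall>x\<in>disc a. 1 / C * H t x \<le> G t (\<phi> x) \<and> G t (\<phi> x) \<le> C * H t x \<Longrightarrow> r \<le> ln C"
  shows "ereal r \<le> dT (disc a) lambda_std H G"
  unfolding dT_def
proof (rule Inf_greatest, clarify)
  fix C \<phi> assume "0 < C" "\<phi> \<in> Symp (disc a) lambda_std"
    and *: "\<forall>t. \<forall>x\<in>disc a. 1 / C * H t x \<le> G t (\<phi> x) \<and> G t (\<phi> x) \<le> C * H t x"
  then have "r \<le> ln C" using HG norm_Symp_disc[OF a] by blast
  then show "ereal r \<le> ereal (ln C)" by simp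
qed

text \<open>The coefficient \<open>v $ i\<close> goes to a monomial of degree at least 2; the linear coefficient
  makes the derivative nonnegative on the unit interval whatever the signs of the others are.\<close>

definition increasing_coeffs :: "('n::finite option \<Rightarrow> nat) \<Rightarrow> real ^ 'n \<Rightarrow> real ^ 'n option" where
  "increasing_coeffs m v =
     (\<chi> p. case p of None \<Rightarrow> \<Sum>i\<in>UNIV. real (m (Some i)) * \<bar>v $ i\<bar> | Some i \<Rightarrow> v $ i)"

lemma sum_UNIV_option:
  "(\<Sum>p\<in>UNIV. g p) = g None + (\<Sum>i\<in>(UNIV :: 'n::finite set). g (Some i))"
  by (simp add: UNIV_option_conv sum.reindex)

text \<open>The linear monomial contributes the constant sum of the
  \<open>m (Some i) * |v $ i|\<close>, which dominates the other terms one by one because powers of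
  \<open>s\<close> are at most 1.\<close>

lemma increasing_coeffs_derivative_nonneg:
  fixes v :: "real ^ 'n"
  assumes "m None = 1" and s: "0 \<le> s" "s \<le> 1"
  shows "0 \<le> (\<Sum>p\<in>UNIV. increasing_coeffs m v $ p * (real (m p) * s ^ (m p - 1)))"
proof -
  have "(\<Sum>p\<in>UNIV. increasing_coeffs m v $ p * (real (m p) * s ^ (m p - 1))) =
      (\<Sum>i\<in>UNIV. real (m (Some i)) * (\<bar>v $ i\<bar> + v $ i * s ^ (m (Some i) - 1)))"
    using assms(1) by (simp add: sum_UNIV_option increasing_coeffs_def sum.distrib algebra_simps)
  also have "\<dots> \<ge> 0"
  proof (intro sum_nonneg mult_nonneg_nonneg)
    fix i
    have "\<bar>v $ i * s ^ (m (Some i) - 1)\<bar> \<le> \<bar>v $ i\<bar>"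
      using s by (simp add: abs_mult power_le_one mult_left_le)
    then show "0 \<le> \<bar>v $ i\<bar> + v $ i * s ^ (m (Some i) - 1)" by linarith
  qed simp
  finally show ?thesis .
qed

lemma infnorm_le_norm_increasing_coeffs:
  "infnorm (v - w) \<le> norm (increasing_coeffs m v - increasing_coeffs m w)"
proof -
  have "\<bar>(v - w) $ i\<bar> \<le> norm (increasing_coeffs m v - increasing_coeffs m w)" for i
    using component_le_norm_cart[of "increasing_coeffs m v - increasing_coeffs m w" "Some i"]
    by (simp add: increasing_coeffs_def)
  then show ?thesis unfolding infnorm_Max by (auto simp: Basis_vec_def cart_eq_inner_axis)
qed

theorem theorem7:
  shows "\<exists>c>0. \<forall>a>0. \<exists>\<Phi> :: real ^ 'n \<Rightarrow> real \<Rightarrow> complex \<Rightarrow> real.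
    (\<forall>v. \<Phi> v \<in> hamiltonians_plus (disc a) lambda_std) \<and>
    (\<forall>v w. dT (disc a) lambda_std (\<Phi> v) (\<Phi> w) \<ge> ereal (c * infnorm (v - w)))"
proof -
  obtain h :: "'n \<Rightarrow> nat" where h: "bij_betw h UNIV {0..<CARD('n)}"
    using ex_bij_betw_finite_nat[OF finite] by blast
  \<comment> \<open>The exponents are the distinct numbers from 1 to \<open>CARD('n) + 1\<close>:
    degree 1 is kept for the correction term, and \<open>h\<close> starts at 0, hence the shift by
    2.\<close>
  define m where "m p = (case p of None \<Rightarrow> 1 | Some i \<Rightarrow> h i + 2)" for p
  have "h i < CARD('n)" for i using bij_betwE[OF h] by auto
  then have m: "m p \<in> {1..CARD('n option)}" for p
    by (auto simp: m_def Suc_le_eq split: option.split)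
  have m_inj: "inj m"
    using bij_betw_imp_inj_on[OF h] by (auto simp: inj_def m_def split: option.splits)
  define x where "x p = 1 / real (m p + 1)" for p
  \<comment> \<open>Being strictly below 1 allows the factor \<open>1 - x p\<close> to be cancelled
    later.\<close>
  have x: "0 < x p" "x p < 1" for p using m[of p] by (auto simp: x_def)
  define e :: "real ^ 'n \<Rightarrow> real ^ 'n option" where "e = increasing_coeffs m"
  define P where "P v s = (\<Sum>j\<in>UNIV. e v $ j * s ^ m j)" for v s
  obtain B where B: "B > 0"
    and bound: "\<And>c :: real ^ 'n option. B * norm c \<le> (\<Sum>p\<in>UNIV. \<bar>\<Sum>j\<in>UNIV. c $ j * x p ^ m j\<bar>)"
    using monomial_evaluation_bounded_below[OF m_inj m] unfolding x_def by blast
  let ?N = "real CARD('n option)"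
  have N: "?N > 0" by simp
  show ?thesis
  \<comment> \<open>\<open>B\<close> is obtained before \<open>a\<close> is fixed, so the constant
    depends only on the dimension. The divisor counts the evaluation points, each of which
    contributes at most \<open>ln C\<close>.\<close>
  proof (rule exI[of _ "B / ?N"], intro conjI allI impI)
    show "B / ?N > 0" using B N by simp
    fix a :: real assume a: "a > 0"
    define s where "s z = pi / a * (cmod z)\<^sup>2" for z
    define \<Phi> :: "real ^ 'n \<Rightarrow> real \<Rightarrow> complex \<Rightarrow> real"
      where "\<Phi> v t z = (1 - s z) * exp (- P v (s z))" for v t z
    have "\<Phi> v \<in> hamiltonians_plus (disc a) lambda_std" for v
    proof -
      have "real_polynomial_function (P v)"
        unfolding P_def
        by (intro real_polynomial_function_sum real_polynomial_function.intros(2,4)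
          real_polynomial_function_power real_polynomial_function.intros(1)[OF bounded_linear_ident]) simp
      moreover have "(P v has_real_derivative (\<Sum>p\<in>UNIV. e v $ p * (real (m p) * y ^ (m p - 1)))) (at y)" for y
        unfolding P_def by (auto intro!: derivative_eq_intros sum.cong)
      moreover have "0 \<le> (\<Sum>p\<in>UNIV. e v $ p * (real (m p) * y ^ (m p - 1)))" if "0 \<le> y" "y \<le> 1" for y
        using that increasing_coeffs_derivative_nonneg[of m y v] unfolding e_def by (simp add: m_def)
      ultimately have "(\<lambda>t z. (1 - s z) * exp (- P v (s z))) \<in> hamiltonians_plus (disc a) lambda_std"
        by (rule radial_in_hamiltonians_plus[OF a]) (auto simp: s_def)
      then show ?thesis by (simp add: \<Phi>_def[abs_def])
    qed
    moreover have "ereal (B / ?N * infnorm (v - w)) \<le> dT (disc a) lambda_std (\<Phi> v) (\<Phi> w)" for v w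
    proof (rule le_dT_disc[OF a])
      fix C \<phi> assume C: "(C::real) > 0" and \<phi>: "\<forall>z\<in>disc a. cmod (\<phi> z) = cmod z"
        and le: "\<forall>t. \<forall>z\<in>disc a. 1 / C * \<Phi> v t z \<le> \<Phi> w t (\<phi> z) \<and> \<Phi> w t (\<phi> z) \<le> C * \<Phi> v t z"
      have P_diff: "\<bar>P v (x p) - P w (x p)\<bar> \<le> ln C" for p
      proof -
        \<comment> \<open>A point of the disc at level \<open>s z = x p\<close>. Since
          \<open>\<phi>\<close> preserves the norm, \<open>\<phi> z\<close> lies on the same level,
          and the comparison involves only \<open>P v\<close> and \<open>P w\<close> at
          \<open>x p\<close>.\<close>
        define z where "z = complex_of_real (sqrt (x p * a / pi))"
        have "(cmod z)\<^sup>2 = x p * a / pi" using x[of p] a by (simp add: z_def)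
        then have s: "s z = x p" and "pi * (cmod z)\<^sup>2 = x p * a" using a by (simp_all add: s_def)
        then have z: "z \<in> disc a" using x[of p] a by (simp add: disc_def)
        then have "s (\<phi> z) = x p" using \<phi> s by (simp add: s_def)
        with le z s have "1 / C * ((1 - x p) * exp (- P v (x p))) \<le> (1 - x p) * exp (- P w (x p))"
          "(1 - x p) * exp (- P w (x p)) \<le> C * ((1 - x p) * exp (- P v (x p)))"
          by (auto simp: \<Phi>_def)
        then have "(1 - x p) * (exp (- P v (x p)) / C) \<le> (1 - x p) * exp (- P w (x p))"
          "(1 - x p) * exp (- P w (x p)) \<le> (1 - x p) * (C * exp (- P v (x p)))"
          by (simp_all only: mult_ac times_divide_eq_right times_divide_eq_left mult_1)
        then have "exp (- P v (x p)) / C \<le> exp (- P w (x p))" "exp (- P w (x p)) \<le> C * exp (- P v (x p))"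
          using x[of p] by (simp_all only: mult_le_cancel_left_pos diff_gt_0_iff_gt)
        then have "exp (- P v (x p)) \<le> C * exp (- P w (x p))" "exp (- P w (x p)) \<le> C * exp (- P v (x p))"
          using C by (simp_all only: pos_divide_le_eq mult.commute)
        moreover have "C = exp (ln C)" using C by simp
        ultimately have "exp (- P v (x p)) \<le> exp (ln C - P w (x p))" "exp (- P w (x p)) \<le> exp (ln C - P v (x p))"
          by (simp_all add: exp_diff exp_minus field_simps)
        then show ?thesis by simp
      qed
      have "B * infnorm (v - w) \<le> B * norm (e v - e w)"
        using B infnorm_le_norm_increasing_coeffs[of v w m] by (simp add: e_def)
      also have "\<dots> \<le> (\<Sum>p\<in>UNIV. \<bar>P v (x p) - P w (x p)\<bar>)"
        using bound[of "e v - e w"] by (simp add: P_def sum_subtractf left_diff_distrib)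
      also have "\<dots> \<le> ?N * ln C"
        using sum_bounded_above[of UNIV "\<lambda>p. \<bar>P v (x p) - P w (x p)\<bar>" "ln C"] P_diff by simp
      finally show "B / ?N * infnorm (v - w) \<le> ln C"
        using N by (simp add: field_simps)
    qed
    ultimately show "\<exists>\<Phi> :: real ^ 'n \<Rightarrow> real \<Rightarrow> complex \<Rightarrow> real.
      (\<forall>v. \<Phi> v \<in> hamiltonians_plus (disc a) lambda_std) \<and>
      (\<forall>v w. dT (disc a) lambda_std (\<Phi> v) (\<Phi> w) \<ge> ereal (B / ?N * infnorm (v - w)))"
      by blast
  qed
qed

end
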